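(* Let $H$ be a Hopf algebra over a field $\mathbb F$ (with multiplication $m$, coproduct $\Delta$, unit $1$, counit $\varepsilon$ and invertible antipode $S$) with a Hopf pairing $\varphi$. Then the vector space $H$ equipped with the multiplication $$a\ast b=\sum\varphi(b_{(2)},a_{(1)})\,a_{(2)}b_{(1)},\qquad a,b\in H,$$ (the iHopf algebra $H^\imath$) is an associative algebra with unit $1$.
   Context: Sweedler notation: $\Delta(a)=\sum a_{(1)}\otimes a_{(2)}$. A Hopf pairing on $H$ is a bilinear form $\varphi:H\times H\to\mathbb F$ with $\varphi(a,1)=\varepsilon(a)$, $\varphi(1,b)=\varepsilon(b)$, $\varphi(a,bb')=\varphi(\Delta(a),b\otimes b')$, $\varphi(aa',b)=\varphi(a\otimes a',\Delta(b))$, $\varphi(a,S(b))=\varphi(S(a),b)$, where $\varphi(a\otimes a',b\otimes b')=\varphi(a,b)\varphi(a',b')$. *)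

theory Defs
  imports "HOL.Vector_Spaces" "HOL-Library.Poly_Mapping"
begin

text \<open>The free vector space on a type \<open>'x\<close> is \<open>'x \<Rightarrow>\<^sub>0 'f\<close>; tensor powers of a vector space are
  quotients of free vector spaces on tuples by the multilinearity relations.\<close>

definition free_scale :: "'f::field \<Rightarrow> ('x \<Rightarrow>\<^sub>0 'f) \<Rightarrow> ('x \<Rightarrow>\<^sub>0 'f)" where
  "free_scale c p = Poly_Mapping.map ((*) c) p"

lemma lookup_free_scale [simp]:
  "Poly_Mapping.lookup (free_scale c p) k = c * Poly_Mapping.lookup p k"
  by (simp add: free_scale_def Poly_Mapping.map.rep_eq when_def)

lemma vector_space_free_scale: "vector_space free_scale"
  by unfold_locales (simp_all add: poly_mapping_eq_iff fun_eq_iff lookup_add algebra_simps)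

abbreviation gen :: "'x \<Rightarrow> ('x \<Rightarrow>\<^sub>0 'f::field)" where
  "gen k \<equiv> Poly_Mapping.single k 1"

definition linear_extension ::
  "('f::field \<Rightarrow> 'c::ab_group_add \<Rightarrow> 'c) \<Rightarrow> ('x \<Rightarrow> 'c) \<Rightarrow> ('x \<Rightarrow>\<^sub>0 'f) \<Rightarrow> 'c" where
  "linear_extension s f p = (\<Sum>k\<in>Poly_Mapping.keys p. s (Poly_Mapping.lookup p k) (f k))"

definition bilinear_relators ::
  "('f::field \<Rightarrow> 'a::ab_group_add \<Rightarrow> 'a) \<Rightarrow> ('a \<times> 'a \<Rightarrow>\<^sub>0 'f) set" where
  "bilinear_relators s =
     {gen (x + x', y) - gen (x, y) - gen (x', y) |x x' y. True} \<union>
     {gen (x, y + y') - gen (x, y) - gen (x, y') |x y y'. True} \<union>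
     {gen (s c x, y) - free_scale c (gen (x, y)) |c x y. True} \<union>
     {gen (x, s c y) - free_scale c (gen (x, y)) |c x y. True}"

definition trilinear_relators ::
  "('f::field \<Rightarrow> 'a::ab_group_add \<Rightarrow> 'a) \<Rightarrow> ('a \<times> 'a \<times> 'a \<Rightarrow>\<^sub>0 'f) set" where
  "trilinear_relators s =
     {gen (x + x', y, z) - gen (x, y, z) - gen (x', y, z) |x x' y z. True} \<union>
     {gen (x, y + y', z) - gen (x, y, z) - gen (x, y', z) |x y y' z. True} \<union>
     {gen (x, y, z + z') - gen (x, y, z) - gen (x, y, z') |x y z z'. True} \<union>
     {gen (s c x, y, z) - free_scale c (gen (x, y, z)) |c x y z. True} \<union>
     {gen (x, s c y, z) - free_scale c (gen (x, y, z)) |c x y z. True} \<union>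
     {gen (x, y, s c z) - free_scale c (gen (x, y, z)) |c x y z. True}"

definition tensor2_rel ::
  "('f::field \<Rightarrow> 'a::ab_group_add \<Rightarrow> 'a) \<Rightarrow> (('a \<times> 'a \<Rightarrow>\<^sub>0 'f) \<times> ('a \<times> 'a \<Rightarrow>\<^sub>0 'f)) set" where
  "tensor2_rel s = {(p, q). p - q \<in> module.span free_scale (bilinear_relators s)}"

definition tensor3_rel ::
  "('f::field \<Rightarrow> 'a::ab_group_add \<Rightarrow> 'a) \<Rightarrow>
     (('a \<times> 'a \<times> 'a \<Rightarrow>\<^sub>0 'f) \<times> ('a \<times> 'a \<times> 'a \<Rightarrow>\<^sub>0 'f)) set" where
  "tensor3_rel s = {(p, q). p - q \<in> module.span free_scale (trilinear_relators s)}"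

definition tensor2 ::
  "('f::field \<Rightarrow> 'a::ab_group_add \<Rightarrow> 'a) \<Rightarrow> ('a \<times> 'a \<Rightarrow>\<^sub>0 'f) set set" where
  "tensor2 s = UNIV // tensor2_rel s"

definition class2 ::
  "('f::field \<Rightarrow> 'a::ab_group_add \<Rightarrow> 'a) \<Rightarrow> ('a \<times> 'a \<Rightarrow>\<^sub>0 'f) \<Rightarrow> ('a \<times> 'a \<Rightarrow>\<^sub>0 'f) set" where
  "class2 s p = tensor2_rel s `` {p}"

definition class3 ::
  "('f::field \<Rightarrow> 'a::ab_group_add \<Rightarrow> 'a) \<Rightarrow>
     ('a \<times> 'a \<times> 'a \<Rightarrow>\<^sub>0 'f) \<Rightarrow> ('a \<times> 'a \<times> 'a \<Rightarrow>\<^sub>0 'f) set" where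
  "class3 s p = tensor3_rel s `` {p}"

text \<open>Sweedler notation chooses an expression \<open>t = \<Sum> c\<^sub>i x\<^sub>i \<otimes> y\<^sub>i\<close>; \<open>rep t\<close> is that choice. If
  \<open>\<beta>\<close> is bilinear, then \<open>tensor_lift s \<beta>\<close> is the linear map on the tensor square with
  \<open>x \<otimes> y \<mapsto> \<beta> x y\<close>, whatever the choice (lemma \<open>tensor_lift_class2\<close>). When the target is itself a
  tensor power, \<open>\<beta>\<close> takes values in the free space above it, and the result is passed to the
  quotient by \<open>class2\<close> or \<open>class3\<close>; bilinearity modulo the relators then suffices.\<close>

definition rep :: "('x \<Rightarrow>\<^sub>0 'f::field) set \<Rightarrow> ('x \<Rightarrow>\<^sub>0 'f)" where
  "rep t = (SOME p. p \<in> t)"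

definition tensor_lift ::
  "('f::field \<Rightarrow> 'c::ab_group_add \<Rightarrow> 'c) \<Rightarrow> ('a \<Rightarrow> 'a \<Rightarrow> 'c) \<Rightarrow> ('a \<times> 'a \<Rightarrow>\<^sub>0 'f) set \<Rightarrow> 'c" where
  "tensor_lift s \<beta> t = linear_extension s (\<lambda>(x, y). \<beta> x y) (rep t)"

definition bilinear_map ::
  "('f::field \<Rightarrow> 'a::ab_group_add \<Rightarrow> 'a) \<Rightarrow> ('f \<Rightarrow> 'b::ab_group_add \<Rightarrow> 'b) \<Rightarrow>
     ('f \<Rightarrow> 'c::ab_group_add \<Rightarrow> 'c) \<Rightarrow> ('a \<Rightarrow> 'b \<Rightarrow> 'c) \<Rightarrow> bool" where
  "bilinear_map s1 s2 s3 \<beta> \<longleftrightarrow>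
     (\<forall>y. Vector_Spaces.linear s1 s3 (\<lambda>x. \<beta> x y)) \<and> (\<forall>x. Vector_Spaces.linear s2 s3 (\<beta> x))"

lemma linear_linear_extension:
  assumes "vector_space s"
  shows "Vector_Spaces.linear free_scale s (linear_extension s f)"
proof -
  interpret s: vector_space s by fact
  interpret free: vector_space "free_scale :: 'a \<Rightarrow> ('c \<Rightarrow>\<^sub>0 'a) \<Rightarrow> _"
    by (rule vector_space_free_scale)
  have sup: "linear_extension s f p = (\<Sum>k\<in>K. s (Poly_Mapping.lookup p k) (f k))"
    if "finite K" "Poly_Mapping.keys p \<subseteq> K" for p K
    unfolding linear_extension_def using that
    by (intro sum.mono_neutral_left) (auto simp: in_keys_iff)
  show ?thesis
  proof
    fix p q :: "'c \<Rightarrow>\<^sub>0 'a"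
    let ?K = "Poly_Mapping.keys p \<union> Poly_Mapping.keys q"
    have "Poly_Mapping.keys (p + q) \<subseteq> ?K" by (rule keys_add)
    then show "linear_extension s f (p + q) = linear_extension s f p + linear_extension s f q"
      by (simp add: sup[of ?K] lookup_add s.scale_left_distrib sum.distrib)
  next
    fix c and p :: "'c \<Rightarrow>\<^sub>0 'a"
    have "Poly_Mapping.keys (free_scale c p) \<subseteq> Poly_Mapping.keys p"
      by (auto simp: in_keys_iff)
    then show "linear_extension s f (free_scale c p) = s c (linear_extension s f p)"
      by (simp add: sup[of "Poly_Mapping.keys p"] s.scale_sum_right)
  qed
qed

lemma tensor_lift_class2:
  assumes "bilinear_map s s s' \<beta>"
  shows "tensor_lift s' \<beta> (class2 s p) = linear_extension s' (\<lambda>(x, y). \<beta> x y) p"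
proof -
  let ?L = "linear_extension s' (\<lambda>(x, y). \<beta> x y)"
  have lin1: "Vector_Spaces.linear s s' (\<lambda>x. \<beta> x y)" and lin2: "Vector_Spaces.linear s s' (\<beta> x)"
    for x y using assms by (auto simp: bilinear_map_def)
  then interpret s': vector_space s' by (simp add: Vector_Spaces.linear_def)
  interpret L: Vector_Spaces.linear free_scale s' ?L
    by (rule linear_linear_extension) unfold_locales
  have gen: "?L (gen (x, y)) = \<beta> x y" for x y
    by (simp add: linear_extension_def)
  have base: "?L r = 0" if "r \<in> bilinear_relators s" for r
    using that unfolding bilinear_relators_def
    by (auto simp: L.diff L.scale gen lin1[THEN linear.axioms(3), THEN module_hom.add]
        lin2[THEN linear.axioms(3), THEN module_hom.add]
        lin1[THEN linear.axioms(3), THEN module_hom.scale]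
        lin2[THEN linear.axioms(3), THEN module_hom.scale])
  have *: "?L r = 0" if "r \<in> module.span free_scale (bilinear_relators s)" for r
    using that by (induction rule: L.vs1.span_induct_alt) (auto simp: base L.add L.scale L.zero)
  have "p \<in> class2 s p"
    by (simp add: class2_def tensor2_rel_def L.vs1.span_zero)
  then have "rep (class2 s p) \<in> class2 s p"
    unfolding rep_def by (rule someI)
  then have "?L (p - rep (class2 s p)) = 0"
    by (intro *) (simp add: class2_def tensor2_rel_def)
  then show ?thesis
    by (simp add: tensor_lift_def L.diff)
qed

locale assoc_algebra = vector_space scale
  for scale :: "'f::field \<Rightarrow> 'a::ab_group_add \<Rightarrow> 'a" +
  fixes mult :: "'a \<Rightarrow> 'a \<Rightarrow> 'a" and one :: 'a
  assumes mult_bilinear: "bilinear_map scale scale scale mult"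
    and mult_assoc: "mult (mult a b) c = mult a (mult b c)"
    and mult_one_left: "mult one a = a"
    and mult_one_right: "mult a one = a"

locale hopf_algebra = assoc_algebra scale mult one
  for scale :: "'f::field \<Rightarrow> 'a::ab_group_add \<Rightarrow> 'a"
    and mult :: "'a \<Rightarrow> 'a \<Rightarrow> 'a" and one :: 'a +
  fixes comult :: "'a \<Rightarrow> ('a \<times> 'a \<Rightarrow>\<^sub>0 'f) set"
    and counit :: "'a \<Rightarrow> 'f"
    and antipode :: "'a \<Rightarrow> 'a"
  assumes comult_in: "comult a \<in> tensor2 scale"
    and comult_add: "comult (a + b) = class2 scale (rep (comult a) + rep (comult b))"
    and comult_scale: "comult (scale c a) = class2 scale (free_scale c (rep (comult a)))"
    and coassoc:
      "class3 scale (tensor_lift free_scale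
         (\<lambda>x y. tensor_lift free_scale (\<lambda>u v. gen (u, v, y)) (comult x)) (comult a)) =
       class3 scale (tensor_lift free_scale
         (\<lambda>x y. tensor_lift free_scale (\<lambda>u v. gen (x, u, v)) (comult y)) (comult a))"
    and counit_linear: "Vector_Spaces.linear scale (*) counit"
    and counit_left: "tensor_lift scale (\<lambda>x y. scale (counit x) y) (comult a) = a"
    and counit_right: "tensor_lift scale (\<lambda>x y. scale (counit y) x) (comult a) = a"
    and comult_mult:
      "comult (mult a b) = class2 scale (tensor_lift free_scale
         (\<lambda>x y. tensor_lift free_scale (\<lambda>u v. gen (mult x u, mult y v)) (comult b)) (comult a))"
    and comult_one: "comult one = class2 scale (gen (one, one))"
    and counit_mult: "counit (mult a b) = counit a * counit b"
    and counit_one: "counit one = 1"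
    and antipode_linear: "Vector_Spaces.linear scale scale antipode"
    and antipode_left:
      "tensor_lift scale (\<lambda>x y. mult (antipode x) y) (comult a) = scale (counit a) one"
    and antipode_right:
      "tensor_lift scale (\<lambda>x y. mult x (antipode y)) (comult a) = scale (counit a) one"

text \<open>The form on the tensor square with
  \<open>\<phi>(a \<otimes> a', b \<otimes> b') = \<phi>(a, b) \<phi>(a', b')\<close>.\<close>

definition pairing2 ::
  "('a \<Rightarrow> 'a \<Rightarrow> 'f::field) \<Rightarrow> ('a \<times> 'a \<Rightarrow>\<^sub>0 'f) set \<Rightarrow> ('a \<times> 'a \<Rightarrow>\<^sub>0 'f) set \<Rightarrow> 'f" where
  "pairing2 \<phi> t u =
     tensor_lift (*) (\<lambda>a a'. tensor_lift (*) (\<lambda>b b'. \<phi> a b * \<phi> a' b') u) t"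

locale hopf_pairing = hopf_algebra scale mult one comult counit antipode
  for scale :: "'f::field \<Rightarrow> 'a::ab_group_add \<Rightarrow> 'a"
    and mult :: "'a \<Rightarrow> 'a \<Rightarrow> 'a" and one :: 'a
    and comult :: "'a \<Rightarrow> ('a \<times> 'a \<Rightarrow>\<^sub>0 'f) set"
    and counit :: "'a \<Rightarrow> 'f"
    and antipode :: "'a \<Rightarrow> 'a" +
  fixes \<phi> :: "'a \<Rightarrow> 'a \<Rightarrow> 'f"
  assumes pairing_bilinear: "bilinear_map scale scale (*) \<phi>"
    and pairing_one_right: "\<phi> a one = counit a"
    and pairing_one_left: "\<phi> one b = counit b"
    and pairing_mult_right: "\<phi> a (mult b b') = pairing2 \<phi> (comult a) (class2 scale (gen (b, b')))"
    and pairing_mult_left: "\<phi> (mult a a') b = pairing2 \<phi> (class2 scale (gen (a, a'))) (comult b)"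
    and pairing_antipode: "\<phi> a (antipode b) = \<phi> (antipode a) b"

definition ihopf_mult ::
  "('f::field \<Rightarrow> 'a::ab_group_add \<Rightarrow> 'a) \<Rightarrow> ('a \<Rightarrow> 'a \<Rightarrow> 'a) \<Rightarrow> ('a \<Rightarrow> ('a \<times> 'a \<Rightarrow>\<^sub>0 'f) set) \<Rightarrow>
     ('a \<Rightarrow> 'a \<Rightarrow> 'f) \<Rightarrow> 'a \<Rightarrow> 'a \<Rightarrow> 'a" where
  "ihopf_mult scale mult comult \<phi> a b =
     tensor_lift scale (\<lambda>a1 a2.
       tensor_lift scale (\<lambda>b1 b2. scale (\<phi> b2 a1) (mult a2 b1)) (comult b)) (comult a)"

end

theory Submission
  imports Defs
begin

text \<open>Both bracketings of a triple product expand to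
  \<open>\<Sum> \<phi>(b\<^sub>3, a\<^sub>1) \<phi>(c\<^sub>2, a\<^sub>2) \<phi>(c\<^sub>3, b\<^sub>1) a\<^sub>3 b\<^sub>2 c\<^sub>1\<close>. This uses multiplicativity of the coproduct
  and of the pairing; the iterated coproducts of \<open>a\<close>, \<open>b\<close>, \<open>c\<close> come out bracketed
  oppositely on the two sides, so coassociativity is applied once to each.\<close>

section \<open>Linear extensions from free vector spaces\<close>

lemma vector_space_field: "vector_space ((*) :: 'f::field \<Rightarrow> 'f \<Rightarrow> 'f)"
  by unfold_locales (simp_all add: algebra_simps)

lemma linear_extension_gen:
  assumes "vector_space s"
  shows "linear_extension s f (gen k) = f k"
proof -
  interpret vector_space s by fact
  show ?thesis by (simp add: linear_extension_def)
qed

lemma linear_map_linear_extension: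
  assumes "Vector_Spaces.linear s1 s2 h"
  shows "h (linear_extension s1 f p) = linear_extension s2 (\<lambda>k. h (f k)) p"
proof -
  interpret Vector_Spaces.linear s1 s2 h by fact
  show ?thesis by (simp add: linear_extension_def sum scale)
qed

lemma linear_extension_linear_parameter:
  assumes "\<And>k. Vector_Spaces.linear s1 s2 (\<lambda>x. F x k)"
  shows "Vector_Spaces.linear s1 s2 (\<lambda>x. linear_extension s2 (F x) p)"
proof -
  interpret vector_space s2 using assms by (simp add: Vector_Spaces.linear_iff)
  show ?thesis
    using assms
    by (simp add: Vector_Spaces.linear_iff linear_extension_def scale_right_distrib sum.distrib
        scale_sum_right mult.commute)
qed

lemma linear_extension_swap:
  assumes "vector_space s"
  shows "linear_extension s (\<lambda>k. linear_extension s (F k) q) p =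
         linear_extension s (\<lambda>l. linear_extension s (\<lambda>k. F k l) p) q"
proof -
  interpret vector_space s by fact
  show ?thesis
    unfolding linear_extension_def
    by (simp add: scale_sum_right mult.commute) (rule sum.swap)
qed

text \<open>The extension of a trilinear map kills every trilinear relator, hence their span, and
  \<open>p - q\<close> lies in that span. This turns equalities in the tensor cube, such as
  coassociativity, into equalities of values.\<close>

lemma linear_extension_class3_cong:
  assumes "class3 s p = class3 s q"
    and "\<And>y z. Vector_Spaces.linear s s' (\<lambda>x. T x y z)"
    and "\<And>x z. Vector_Spaces.linear s s' (\<lambda>y. T x y z)"
    and "\<And>x y. Vector_Spaces.linear s s' (\<lambda>z. T x y z)"
  shows "linear_extension s' (\<lambda>(x, y, z). T x y z) p = linear_extension s' (\<lambda>(x, y, z). T x y z) q"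
proof -
  let ?L = "linear_extension s' (\<lambda>(x, y, z). T x y z)"
  have vs: "vector_space s'" using assms(2) by (simp add: Vector_Spaces.linear_iff)
  interpret L: Vector_Spaces.linear free_scale s' ?L
    by (rule linear_linear_extension[OF vs])
  have base: "?L r = 0" if "r \<in> trilinear_relators s" for r
    using that assms(2-4) unfolding trilinear_relators_def Vector_Spaces.linear_iff
    by (auto simp: L.diff L.scale linear_extension_gen[OF vs])
  have *: "?L r = 0" if "r \<in> module.span free_scale (trilinear_relators s)" for r
    using that by (induction rule: L.vs1.span_induct_alt) (auto simp: base L.add L.scale L.zero)
  have "q \<in> class3 s q"
    by (simp add: class3_def tensor3_rel_def L.vs1.span_zero)
  then have "q \<in> class3 s p" using assms(1) by simp
  then have "?L (p - q) = 0" by (intro *) (simp add: class3_def tensor3_rel_def)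
  then show ?thesis by (simp add: L.diff)
qed

section \<open>Sweedler calculus in a Hopf algebra\<close>

context hopf_algebra
begin

text \<open>\<open>sweedler s \<beta> a\<close> is \<open>\<Sum> \<beta>(a\<^sub>1, a\<^sub>2)\<close>, with values in the space with scalar action \<open>s\<close>.\<close>

definition sweedler :: "('f \<Rightarrow> 'c::ab_group_add \<Rightarrow> 'c) \<Rightarrow> ('a \<Rightarrow> 'a \<Rightarrow> 'c) \<Rightarrow> 'a \<Rightarrow> 'c" where
  "sweedler s \<beta> a = tensor_lift s \<beta> (comult a)"

lemma sweedler_rep: "sweedler s \<beta> a = linear_extension s (\<lambda>(x, y). \<beta> x y) (rep (comult a))"
  by (simp add: sweedler_def tensor_lift_def)

text \<open>Each coproduct enters through one fixed representative, so this is an exchange of two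
  finite sums.\<close>

lemma sweedler_swap:
  assumes "vector_space s"
  shows "sweedler s (\<lambda>x y. sweedler s (\<lambda>u v. B x y u v) b) a =
         sweedler s (\<lambda>u v. sweedler s (\<lambda>x y. B x y u v) a) b"
  using linear_extension_swap[OF assms, of "\<lambda>k l. B (fst k) (snd k) (fst l) (snd l)"
      "rep (comult b)" "rep (comult a)"]
  by (simp add: sweedler_rep case_prod_unfold)

lemma linear_map_sweedler:
  assumes "Vector_Spaces.linear s1 s2 h"
  shows "h (sweedler s1 \<beta> a) = sweedler s2 (\<lambda>x y. h (\<beta> x y)) a"
  by (simp add: sweedler_rep linear_map_linear_extension[OF assms] case_prod_unfold)

lemma sweedler_linear_parameter:
  assumes "\<And>u v. Vector_Spaces.linear s1 s2 (\<lambda>x. B x u v)"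
  shows "Vector_Spaces.linear s1 s2 (\<lambda>x. sweedler s2 (B x) a)"
  unfolding sweedler_rep
  by (rule linear_extension_linear_parameter) (simp add: case_prod_unfold assms)

lemma sweedler_linear:
  assumes "\<And>y. Vector_Spaces.linear scale s (\<lambda>x. \<beta> x y)"
    and "\<And>x. Vector_Spaces.linear scale s (\<beta> x)"
  shows "Vector_Spaces.linear scale s (sweedler s \<beta>)"
proof -
  have bil: "bilinear_map scale scale s \<beta>" using assms by (simp add: bilinear_map_def)
  have vs: "vector_space s" using assms by (simp add: Vector_Spaces.linear_iff)
  interpret L: Vector_Spaces.linear free_scale s "linear_extension s (\<lambda>(x, y). \<beta> x y)"
    by (rule linear_linear_extension[OF vs])
  show ?thesis
    unfolding Vector_Spaces.linear_iff
    \<comment> \<open>\<open>comult (a + b)\<close> is known only as a class, so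
      \<open>tensor_lift_class2\<close> must evaluate it while \<open>tensor_lift\<close> is still
      folded; only then are the lifts at \<open>a\<close> and \<open>b\<close> opened to sums over
      \<open>rep\<close>.\<close>
    by (simp add: vs vector_space_axioms sweedler_def comult_add comult_scale
        tensor_lift_class2[OF bil] L.add L.scale)
       (simp add: tensor_lift_def)
qed

lemma sweedler_linear_compose:
  assumes "Vector_Spaces.linear s1 scale g"
    and "\<And>y. Vector_Spaces.linear scale s (\<lambda>x. \<beta> x y)"
    and "\<And>x. Vector_Spaces.linear scale s (\<lambda>y. \<beta> x y)"
  shows "Vector_Spaces.linear s1 s (\<lambda>x. sweedler s \<beta> (g x))"
  using assms(1) sweedler_linear[OF assms(2,3)] by (simp add: Vector_Spaces.linear_iff)

lemma linear_mult:
  "Vector_Spaces.linear s1 scale g \<Longrightarrow> Vector_Spaces.linear s1 scale (\<lambda>x. mult (g x) b)"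
  "Vector_Spaces.linear s1 scale g \<Longrightarrow> Vector_Spaces.linear s1 scale (\<lambda>x. mult b (g x))"
  using mult_bilinear by (simp_all add: bilinear_map_def Vector_Spaces.linear_iff)

lemma linear_times:
  "Vector_Spaces.linear s1 (*) g \<Longrightarrow> Vector_Spaces.linear s1 (*) (\<lambda>x. g x * (c :: 'f))"
  "Vector_Spaces.linear s1 (*) g \<Longrightarrow> Vector_Spaces.linear s1 (*) (\<lambda>x. (c :: 'f) * g x)"
  by (simp_all add: Vector_Spaces.linear_iff algebra_simps)

lemma linear_scale_compose:
  "Vector_Spaces.linear s1 (*) h \<Longrightarrow> Vector_Spaces.linear s1 scale (\<lambda>x. scale (h x) z)"
  "Vector_Spaces.linear s1 scale g \<Longrightarrow> Vector_Spaces.linear s1 scale (\<lambda>x. scale c (g x))"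
  by (simp_all add: Vector_Spaces.linear_iff vector_space_axioms scale_left_distrib scale_right_distrib
      mult.commute)

lemma linear_identity:
  "Vector_Spaces.linear scale scale (\<lambda>x. x)"
  "Vector_Spaces.linear (*) (*) (\<lambda>x. x :: 'f)"
  by (simp_all add: Vector_Spaces.linear_iff vector_space_axioms vector_space_field)

text \<open>These decompose linearity goals by syntax: \<open>sweedler_linear_parameter\<close>
  treats a variable in the summand, \<open>sweedler_linear_compose\<close> one inside the element
  being comultiplied.\<close>

lemmas linear_rules = linear_identity linear_mult linear_times linear_scale_compose
  sweedler_linear_parameter sweedler_linear_compose

lemma sweedler_coassoc:
  assumes "\<And>y z. Vector_Spaces.linear scale s (\<lambda>x. T x y z)"
    and "\<And>x z. Vector_Spaces.linear scale s (\<lambda>y. T x y z)"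
    and "\<And>x y. Vector_Spaces.linear scale s (\<lambda>z. T x y z)"
  shows "sweedler s (\<lambda>x y. sweedler s (\<lambda>u v. T u v y) x) a =
         sweedler s (\<lambda>x y. sweedler s (\<lambda>u v. T x u v) y) a"
proof -
  have vs: "vector_space s" using assms(1) by (simp add: Vector_Spaces.linear_iff)
  show ?thesis
    \<comment> \<open>The extension of \<open>T\<close> passes through both nested lifts in
      \<open>coassoc\<close> and sends each generator to a value of \<open>T\<close>.\<close>
    using linear_extension_class3_cong[OF coassoc assms, of a]
    by (simp add: tensor_lift_def sweedler_rep case_prod_unfold linear_extension_gen[OF vs]
        linear_map_linear_extension[OF linear_linear_extension[OF vs]])
qed

lemma sweedler_mult:
  assumes "\<And>y. Vector_Spaces.linear scale s (\<lambda>x. \<beta> x y)"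
    and "\<And>x. Vector_Spaces.linear scale s (\<lambda>y. \<beta> x y)"
  shows "sweedler s \<beta> (mult a b) =
         sweedler s (\<lambda>x y. sweedler s (\<lambda>u v. \<beta> (mult x u) (mult y v)) b) a"
proof -
  have bil: "bilinear_map scale scale s \<beta>" using assms by (simp add: bilinear_map_def)
  have vs: "vector_space s" using assms by (simp add: Vector_Spaces.linear_iff)
  have "sweedler s \<beta> (mult a b) = linear_extension s (\<lambda>(x, y). \<beta> x y) (tensor_lift free_scale
      (\<lambda>x y. tensor_lift free_scale (\<lambda>u v. gen (mult x u, mult y v)) (comult b)) (comult a))"
    unfolding sweedler_def by (simp only: comult_mult tensor_lift_class2[OF bil])
  then show ?thesis
    by (simp add: tensor_lift_def sweedler_rep case_prod_unfold linear_extension_gen[OF vs]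
        linear_map_linear_extension[OF linear_linear_extension[OF vs]])
qed

lemma sweedler_one:
  assumes "\<And>y. Vector_Spaces.linear scale s (\<lambda>x. \<beta> x y)"
    and "\<And>x. Vector_Spaces.linear scale s (\<lambda>y. \<beta> x y)"
  shows "sweedler s \<beta> one = \<beta> one one"
proof -
  have bil: "bilinear_map scale scale s \<beta>" using assms by (simp add: bilinear_map_def)
  have vs: "vector_space s" using assms by (simp add: Vector_Spaces.linear_iff)
  show ?thesis
    by (simp add: sweedler_def comult_one tensor_lift_class2[OF bil] linear_extension_gen[OF vs])
qed

end

section \<open>The Hopf pairing in Sweedler form\<close>

context hopf_pairing
begin

lemma linear_pairing:
  "Vector_Spaces.linear s1 scale g \<Longrightarrow> Vector_Spaces.linear s1 (*) (\<lambda>x. \<phi> (g x) b)"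
  "Vector_Spaces.linear s1 scale g \<Longrightarrow> Vector_Spaces.linear s1 (*) (\<lambda>x. \<phi> b (g x))"
  using pairing_bilinear by (simp_all add: bilinear_map_def Vector_Spaces.linear_iff)

lemmas pairing_linear_rules = linear_rules linear_pairing

lemma pairing_mult_right_sweedler:
  "\<phi> a (mult b b') = sweedler (*) (\<lambda>x y. \<phi> x b * \<phi> y b') a"
proof -
  have "bilinear_map scale scale (*) (\<lambda>b b'. \<phi> x b * \<phi> y b')" for x y
    unfolding bilinear_map_def by (intro conjI allI pairing_linear_rules)
  then show ?thesis
    by (simp add: pairing_mult_right pairing2_def tensor_lift_class2 sweedler_def
        linear_extension_gen[OF vector_space_field])
qed

text \<open>Here the outer lift of \<open>pairing2\<close> is evaluated at a generator, so the whole
  inner sum over the coproduct of \<open>b\<close> must be bilinear in \<open>a\<close> and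
  \<open>a'\<close>.\<close>

lemma pairing_mult_left_sweedler:
  "\<phi> (mult a a') b = sweedler (*) (\<lambda>x y. \<phi> a x * \<phi> a' y) b"
proof -
  have "bilinear_map scale scale (*) (\<lambda>a a'. sweedler (*) (\<lambda>x y. \<phi> a x * \<phi> a' y) b)"
    unfolding bilinear_map_def by (intro conjI allI pairing_linear_rules)
  then show ?thesis
    unfolding pairing_mult_left pairing2_def sweedler_def
    by (simp add: tensor_lift_class2 linear_extension_gen[OF vector_space_field])
qed

abbreviation ihopf (infixl "\<star>" 70) where
  "a \<star> b \<equiv> ihopf_mult scale mult comult \<phi> a b"

lemma ihopf_sweedler:
  "a \<star> b = sweedler scale (\<lambda>a1 a2. sweedler scale (\<lambda>b1 b2. scale (\<phi> b2 a1) (mult a2 b1)) b) a"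
  by (simp add: ihopf_mult_def sweedler_def)

section \<open>Bilinearity and associativity of \<open>\<star>\<close>\<close>

lemma ihopf_linear:
  "Vector_Spaces.linear scale scale (\<lambda>a. a \<star> b)"
  "Vector_Spaces.linear scale scale (\<lambda>b. a \<star> b)"
  unfolding ihopf_sweedler by (intro pairing_linear_rules)+

text \<open>Multiplicativity of the coproduct splits \<open>mult a b\<close>; the pairing of
  \<open>c2\<close> with a product then splits the second leg of \<open>c\<close> once more.\<close>

lemma ihopf_mult_left:
  "mult a b \<star> c = sweedler scale (\<lambda>x y. sweedler scale (\<lambda>u v. sweedler scale (\<lambda>c1 c2.
     sweedler scale (\<lambda>p q. scale (\<phi> p x * \<phi> q u) (mult (mult y v) c1)) c2) c) b) a"
proof -
  \<comment> \<open>The linear map applied to the expanded pairing is the one sending a scalar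
    \<open>r\<close> to \<open>scale r z\<close>.\<close>
  have expand: "scale (\<phi> c2 (mult x u)) z =
      sweedler scale (\<lambda>p q. scale (\<phi> p x * \<phi> q u) z) c2" for c2 x u z
    unfolding pairing_mult_right_sweedler
    by (rule linear_map_sweedler) (intro pairing_linear_rules)
  have "mult a b \<star> c = sweedler scale (\<lambda>x y. sweedler scale (\<lambda>u v. sweedler scale (\<lambda>c1 c2.
     scale (\<phi> c2 (mult x u)) (mult (mult y v) c1)) c) b) a"
    unfolding ihopf_sweedler by (rule sweedler_mult; intro pairing_linear_rules)
  then show ?thesis by (simp only: expand)
qed

text \<open>Dual to the left case: the product now sits in the first slot of the pairing, so it is
  the first leg of \<open>a\<close> that splits again.\<close>

lemma ihopf_mult_right:
  "a \<star> mult b c = sweedler scale (\<lambda>a1 a2. sweedler scale (\<lambda>x y. sweedler scale (\<lambda>u v.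
     sweedler scale (\<lambda>p q. scale (\<phi> v x * \<phi> q y) (mult a2 (mult u p))) c) b) a1) a"
proof -
  have expand: "scale (\<phi> (mult v q) a1) z =
      sweedler scale (\<lambda>x y. scale (\<phi> v x * \<phi> q y) z) a1" for v q a1 z
    unfolding pairing_mult_left_sweedler
    by (rule linear_map_sweedler) (intro pairing_linear_rules)
  have "sweedler scale (\<lambda>b1 b2. scale (\<phi> b2 a1) (mult a2 b1)) (mult b c) =
      sweedler scale (\<lambda>u v. sweedler scale (\<lambda>p q.
        scale (\<phi> (mult v q) a1) (mult a2 (mult u p))) c) b" for a1 a2
    by (rule sweedler_mult; intro pairing_linear_rules)
  then have "a \<star> mult b c = sweedler scale (\<lambda>a1 a2. sweedler scale (\<lambda>u v. sweedler scale (\<lambda>p q.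
     sweedler scale (\<lambda>x y. scale (\<phi> v x * \<phi> q y) (mult a2 (mult u p))) a1) c) b) a"
    by (simp only: ihopf_sweedler expand)
  then show ?thesis
    \<comment> \<open>Pushing the sums over \<open>c\<close> and then \<open>b\<close> inward, in
      the expansion and in the goal, makes the nestings agree.\<close>
    unfolding sweedler_swap[OF vector_space_axioms, where a = c]
    unfolding sweedler_swap[OF vector_space_axioms, where a = b] .
qed

lemma ihopf_assoc: "(a \<star> b) \<star> c = a \<star> (b \<star> c)"
proof -
  note swap = sweedler_swap[OF vector_space_axioms]
  note scale_sweedler = linear_map_sweedler[OF linear_scale_compose(2)[OF linear_identity(1)]]
  \<comment> \<open>The common summand of both bracketings, indexed by the three legs of each of
    \<open>a\<close>, \<open>b\<close>, \<open>c\<close>.\<close>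
  define F where "F a1 a2 a3 b1 b2 b3 c1 c2 c3 =
    scale (\<phi> b3 a1 * \<phi> c2 a2 * \<phi> c3 b1) (mult (mult a3 b2) c1)" for a1 a2 a3 b1 b2 b3 c1 c2 c3
  have left: "(a \<star> b) \<star> c =
    sweedler scale (\<lambda>a1 y. sweedler scale (\<lambda>a2 a3.
      sweedler scale (\<lambda>y b3. sweedler scale (\<lambda>b1 b2.
        sweedler scale (\<lambda>c1 y. sweedler scale (\<lambda>c2 c3. F a1 a2 a3 b1 b2 b3 c1 c2 c3)
          y) c) y) b) y) a"
  proof -
    \<comment> \<open>Linearity in the first argument pulls \<open>\<star> c\<close> inside both
      sums. Expanding \<open>mult a2 b1 \<star> c\<close> then splits the second legs of
      \<open>a\<close> and \<open>c\<close> and the first leg of \<open>b\<close>.\<close>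
    have "(a \<star> b) \<star> c =
      sweedler scale (\<lambda>a1 a2. sweedler scale (\<lambda>b1 b2. scale (\<phi> b2 a1) (mult a2 b1 \<star> c)) b) a"
      unfolding ihopf_sweedler[of a b] linear_map_sweedler[OF ihopf_linear(1)]
      using ihopf_linear(1) by (simp add: Vector_Spaces.linear_iff)
    moreover have "scale r (mult x y \<star> c) = sweedler scale (\<lambda>x y'. sweedler scale (\<lambda>u v.
      sweedler scale (\<lambda>c1 c2. sweedler scale (\<lambda>p q.
        scale (r * \<phi> p x * \<phi> q u) (mult (mult y' v) c1)) c2) c) y) x" for r x y
      by (simp only: ihopf_mult_left scale_sweedler scale_scale mult.assoc)
    ultimately show ?thesis by (simp only: F_def swap[where a = b])
  qed
  have right: "a \<star> (b \<star> c) =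
    sweedler scale (\<lambda>y a3. sweedler scale (\<lambda>a1 a2.
      sweedler scale (\<lambda>b1 y. sweedler scale (\<lambda>b2 b3.
        sweedler scale (\<lambda>y c3. sweedler scale (\<lambda>c1 c2. F a1 a2 a3 b1 b2 b3 c1 c2 c3)
          y) c) y) b) y) a"
  proof -
    have "a \<star> (b \<star> c) =
      sweedler scale (\<lambda>b1 b2. sweedler scale (\<lambda>c1 c2. scale (\<phi> c2 b1) (a \<star> mult b2 c1)) c) b"
      unfolding ihopf_sweedler[of b c] linear_map_sweedler[OF ihopf_linear(2)]
      using ihopf_linear(2) by (simp add: Vector_Spaces.linear_iff)
    \<comment> \<open>The scalar \<open>r\<close>, which becomes \<open>\<phi> c3 b1\<close>, is
      moved last to match the factor order in \<open>F\<close>; \<open>mult_assoc\<close> reconciles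
      the bracketing of the product.\<close>
    moreover have "scale r (a \<star> mult d e) = sweedler scale (\<lambda>a1 a2. sweedler scale (\<lambda>x y.
      sweedler scale (\<lambda>u v. sweedler scale (\<lambda>p q. scale (\<phi> v x * \<phi> q y * r)
        (mult (mult a2 u) p)) e) d) a1) a" for r d e
      by (simp only: ihopf_mult_right scale_sweedler scale_scale mult_assoc mult.commute[of r])
    \<comment> \<open>The sum over \<open>b\<close> is pushed inward first and that over
      \<open>c\<close> afterwards: used together, the two swaps could exchange these sums
      forever.\<close>
    ultimately have "a \<star> (b \<star> c) =
      sweedler scale (\<lambda>c1 c2. sweedler scale (\<lambda>y a3. sweedler scale (\<lambda>a1 a2.
        sweedler scale (\<lambda>b1 y. sweedler scale (\<lambda>b2 b3. sweedler scale (\<lambda>p q.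
          F a1 a2 a3 b1 b2 b3 p q c2) c1) y) b) y) a) c"
      by (simp only: F_def swap[where a = b])
    then show ?thesis by (simp only: swap[where a = c])
  qed
  have coassoc_c:
    "sweedler scale (\<lambda>c1 y. sweedler scale (\<lambda>c2 c3. F a1 a2 a3 b1 b2 b3 c1 c2 c3) y) c =
    sweedler scale (\<lambda>y c3. sweedler scale (\<lambda>c1 c2. F a1 a2 a3 b1 b2 b3 c1 c2 c3) y) c"
    for a1 a2 a3 b1 b2 b3
    unfolding F_def by (rule sweedler_coassoc[symmetric]; intro pairing_linear_rules)
  \<comment> \<open>Hiding the sum over \<open>c\<close> in \<open>G\<close>, and later the one over
    \<open>b\<close> in \<open>K\<close>, leaves a function trilinear in the legs of the next
    element, to which \<open>sweedler_coassoc\<close> applies.\<close>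
  define G where "G a1 a2 a3 b1 b2 b3 =
    sweedler scale (\<lambda>y c3. sweedler scale (\<lambda>c1 c2. F a1 a2 a3 b1 b2 b3 c1 c2 c3) y) c"
    for a1 a2 a3 b1 b2 b3
  have coassoc_b: "sweedler scale (\<lambda>y b3. sweedler scale (\<lambda>b1 b2. G a1 a2 a3 b1 b2 b3) y) b =
    sweedler scale (\<lambda>b1 y. sweedler scale (\<lambda>b2 b3. G a1 a2 a3 b1 b2 b3) y) b" for a1 a2 a3
    unfolding G_def F_def by (rule sweedler_coassoc; intro pairing_linear_rules)
  define K where "K a1 a2 a3 =
    sweedler scale (\<lambda>b1 y. sweedler scale (\<lambda>b2 b3. G a1 a2 a3 b1 b2 b3) y) b" for a1 a2 a3
  have coassoc_a: "sweedler scale (\<lambda>a1 y. sweedler scale (\<lambda>a2 a3. K a1 a2 a3) y) a =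
    sweedler scale (\<lambda>y a3. sweedler scale (\<lambda>a1 a2. K a1 a2 a3) y) a"
    unfolding K_def G_def F_def by (rule sweedler_coassoc[symmetric]; intro pairing_linear_rules)
  show ?thesis
    \<comment> \<open>Working from the innermost sum outward, each coassociativity equation turns
      the nesting of \<open>left\<close> into that of \<open>right\<close>; \<open>a\<close> and
      \<open>c\<close> go from a split second leg to a split first leg, \<open>b\<close> the other
      way.\<close>
    unfolding left right coassoc_c G_def[symmetric] coassoc_b K_def[symmetric] coassoc_a ..
qed

section \<open>Unit laws\<close>

lemma ihopf_one_left: "one \<star> a = a"
proof -
  \<comment> \<open>Since \<open>one\<close> is group-like its sum collapses, and pairing with
    \<open>one\<close> gives the counit on the second leg of \<open>a\<close>.\<close>
  have "one \<star> a = sweedler scale (\<lambda>b1 b2. scale (\<phi> b2 one) (mult one b1)) a"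
    unfolding ihopf_sweedler by (rule sweedler_one; intro pairing_linear_rules)
  then show ?thesis
    by (simp add: pairing_one_right mult_one_left sweedler_def counit_right)
qed

lemma ihopf_one_right: "a \<star> one = a"
proof -
  \<comment> \<open>The sum over \<open>one\<close> is brought outermost so that
    \<open>sweedler_one\<close> can collapse it.\<close>
  have "a \<star> one = sweedler scale (\<lambda>b1 b2. sweedler scale
      (\<lambda>a1 a2. scale (\<phi> b2 a1) (mult a2 b1)) a) one"
    unfolding ihopf_sweedler by (rule sweedler_swap[OF vector_space_axioms])
  also have "\<dots> = sweedler scale (\<lambda>a1 a2. scale (\<phi> one a1) (mult a2 one)) a"
    by (rule sweedler_one; intro pairing_linear_rules)
  finally show ?thesis
    by (simp add: pairing_one_left mult_one_right sweedler_def counit_left)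
qed

end

theorem proposition2p2:
  fixes scale :: "'f::field \<Rightarrow> 'a::ab_group_add \<Rightarrow> 'a"
    and mult :: "'a \<Rightarrow> 'a \<Rightarrow> 'a" and one :: 'a
    and comult :: "'a \<Rightarrow> ('a \<times> 'a \<Rightarrow>\<^sub>0 'f) set"
    and counit :: "'a \<Rightarrow> 'f"
    and antipode :: "'a \<Rightarrow> 'a"
    and \<phi> :: "'a \<Rightarrow> 'a \<Rightarrow> 'f"
  assumes "hopf_algebra scale mult one comult counit antipode"
    and "bij antipode"
    and "hopf_pairing scale mult one comult counit antipode \<phi>"
  shows "assoc_algebra scale (ihopf_mult scale mult comult \<phi>) one"
proof -
  interpret hopf_pairing scale mult one comult counit antipode \<phi> by fact
  show ?thesis
    by unfold_locales
      (simp_all add: bilinear_map_def ihopf_linear ihopf_assoc ihopf_one_left ihopf_one_right)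
qed

end
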